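(* Let $p,q\in[0,1]$ with $p+q=1$ and $p>q$. Then the utility function $\mathsf{U}(F,p)$, as a function of $F\in[0,1]$, is maximised at $$F=F_K=|p-q|.$$
   Context: Binary game: $Z(1),\dots,Z(N)$ are i.i.d. random variables with values in $\{-1,1\}$, $\mathsf{P}(Z(I)=1)=p$, $\mathsf{P}(Z(I)=-1)=q=1-p$. A player with initial wealth $W(0)>0$ bets at each trial $I$ a fixed fraction $F\in[0,1]$ of current wealth, so $W(I)=W(I-1)+F\,W(I-1)Z(I)$, i.e. $W(N)=W(0)\prod_{I=1}^N(1+F Z(I))$. The utility function is $$\mathsf{U}(F,p)=\mathsf{E}\left[\log\left|\frac{W(N)}{W(0)}\right|^{1/N}\right],$$ which equals $p\log(1+F)+q\log(1-F)$. Here $\log$ is the natural logarithm, with $\log 0=-\infty$ and $0\cdot(-\infty)=0$. *)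

theory Defs
  imports "HOL-Probability.Probability"
begin

text \<open>The trials are numbered 1, ..., N. That the Z(i) are identically distributed is expressed by
  the probabilities of the two outcomes, which do not depend on i.\<close>

locale binary_game = prob_space M
  for M :: "'a measure" and N :: nat and Z :: "nat \<Rightarrow> 'a \<Rightarrow> real" and p q :: real +
  assumes trials_pos: "N \<ge> 1"
    and sum_p_q: "p + q = 1"
    and outcome: "\<And>i \<omega>. i \<in> {1..N} \<Longrightarrow> \<omega> \<in> space M \<Longrightarrow> Z i \<omega> \<in> {-1, 1}"
    and indep: "indep_vars (\<lambda>_. borel) Z {1..N}"
    and prob_win: "\<And>i. i \<in> {1..N} \<Longrightarrow> prob {\<omega> \<in> space M. Z i \<omega> = 1} = p"
    and prob_loss: "\<And>i. i \<in> {1..N} \<Longrightarrow> prob {\<omega> \<in> space M. Z i \<omega> = -1} = q"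

primrec wealth :: "real \<Rightarrow> real \<Rightarrow> (nat \<Rightarrow> 'a \<Rightarrow> real) \<Rightarrow> nat \<Rightarrow> 'a \<Rightarrow> real" where
  "wealth W0 F Z 0 \<omega> = W0"
| "wealth W0 F Z (Suc n) \<omega> = wealth W0 F Z n \<omega> + F * wealth W0 F Z n \<omega> * Z (Suc n) \<omega>"

text \<open>The natural logarithm with log 0 = -\<infinity>. It is only applied to nonnegative arguments.\<close>

definition ext_ln :: "real \<Rightarrow> ereal" where
  "ext_ln x = (if x > 0 then ereal (ln x) else -\<infinity>)"

text \<open>The expectation of an extended real random variable, as the integral of the positive part minus
  that of the negative part; the coercion \<^term>\<open>e2ennreal\<close> sends negative numbers to 0.
  The Bochner integral is not available here, since the utility may be -\<infinity>.
  The convention 0 * (-\<infinity>) = 0 is built in: a null set on which the variable is -\<infinity> contributes 0.\<close>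

definition ext_expectation :: "'a measure \<Rightarrow> ('a \<Rightarrow> ereal) \<Rightarrow> ereal" where
  "ext_expectation M X =
     enn2ereal (\<integral>\<^sup>+\<omega>. e2ennreal (X \<omega>) \<partial>M) - enn2ereal (\<integral>\<^sup>+\<omega>. e2ennreal (- X \<omega>) \<partial>M)"

text \<open>The dependence of the utility on p is through the law of the Z(i) under M.\<close>

definition utility :: "'a measure \<Rightarrow> nat \<Rightarrow> (nat \<Rightarrow> 'a \<Rightarrow> real) \<Rightarrow> real \<Rightarrow> real \<Rightarrow> ereal" where
  "utility M N Z W0 F =
     ext_expectation M (\<lambda>\<omega>. ext_ln (\<bar>wealth W0 F Z N \<omega> / W0\<bar> powr (1 / real N)))"

end

theory Submission
  imports Defs
begin

text \<open>Put G = p - q, so that 1 + G = 2 p and 1 - G = 2 q. The tangent line inequality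
  ln (1 + F z) \<le> ln (1 + G z) + (F - G) z / (1 + G z), averaged over the trials, bounds the log growth
  rate of F by that of G plus an error term. The error term has expectation
  (F - G) (p / (2 p) - q / (2 q)) = 0 if q > 0, and (F - 1) / 2 \<le> 0 if q = 0. Hence no explicit value
  of the utility is needed, and the case F = 1, where it may be -\<infinity>, is not special.\<close>

lemma ext_expectation_mono_AE:
  assumes "AE \<omega> in M. X \<omega> \<le> Y \<omega>"
  shows "ext_expectation M X \<le> ext_expectation M Y"
proof -
  have "(\<integral>\<^sup>+\<omega>. e2ennreal (X \<omega>) \<partial>M) \<le> (\<integral>\<^sup>+\<omega>. e2ennreal (Y \<omega>) \<partial>M)"
    by (intro nn_integral_mono_AE eventually_mono[OF assms] e2ennreal_mono)
  moreover have "(\<integral>\<^sup>+\<omega>. e2ennreal (- Y \<omega>) \<partial>M) \<le> (\<integral>\<^sup>+\<omega>. e2ennreal (- X \<omega>) \<partial>M)"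
    by (intro nn_integral_mono_AE eventually_mono[OF assms] e2ennreal_mono) simp
  ultimately show ?thesis
    unfolding ext_expectation_def by (intro ereal_minus_mono) (auto simp: less_eq_ennreal.rep_eq)
qed

lemma ext_expectation_ereal:
  assumes "integrable M f"
  shows "ext_expectation M (\<lambda>\<omega>. ereal (f \<omega>)) = ereal (\<integral>\<omega>. f \<omega> \<partial>M)"
proof -
  have "enn2ereal (\<integral>\<^sup>+\<omega>. ennreal (g \<omega>) \<partial>M) = ereal (enn2real (\<integral>\<^sup>+\<omega>. ennreal (g \<omega>) \<partial>M))"
    if "integrable M g" for g :: "'a \<Rightarrow> real"
  proof -
    have "(\<integral>\<^sup>+\<omega>. ennreal (g \<omega>) \<partial>M) < top"
      using that by (simp add: real_integrable_def less_top)
    then show ?thesis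
      by (metis enn2ereal_ennreal enn2real_nonneg ennreal_enn2real)
  qed
  from this[OF assms] this[of "\<lambda>\<omega>. - f \<omega>"] assms show ?thesis
    by (simp add: ext_expectation_def real_lebesgue_integral_def ennreal.abs_eq)
qed

lemma wealth_eq_prod: "wealth W0 F Z n \<omega> = W0 * (\<Prod>i=1..n. 1 + F * Z i \<omega>)"
  by (induction n) (simp_all add: algebra_simps prod.nat_ivl_Suc')

lemma ext_ln_prod_powr:
  fixes x :: "'i \<Rightarrow> real"
  assumes "\<And>i. i \<in> A \<Longrightarrow> x i > 0"
  shows "ext_ln (\<bar>\<Prod>i\<in>A. x i\<bar> powr a) = ereal (a * (\<Sum>i\<in>A. ln (x i)))"
proof (cases "finite A")
  case True
  have "(\<Prod>i\<in>A. x i) > 0" using assms by (rule prod_pos)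
  moreover have "ln (\<Prod>i\<in>A. x i) = (\<Sum>i\<in>A. ln (x i))"
    by (intro ln_prod) (use True in \<open>auto dest: assms\<close>)
  ultimately show ?thesis by (simp add: ext_ln_def ln_powr)
qed (simp add: ext_ln_def)

lemma ext_ln_prod_powr_le:
  fixes x y :: "'i \<Rightarrow> real"
  assumes "finite A" "a \<ge> 0"
    and x: "\<And>i. i \<in> A \<Longrightarrow> x i \<ge> 0" and y: "\<And>i. i \<in> A \<Longrightarrow> y i > 0"
  shows "ext_ln (\<bar>\<Prod>i\<in>A. x i\<bar> powr a) \<le> ereal (a * (\<Sum>i\<in>A. ln (y i) + (x i - y i) / y i))"
proof (cases "\<exists>i\<in>A. x i = 0")
  case True
  with \<open>finite A\<close> have "(\<Prod>i\<in>A. x i) = 0" by (simp add: prod_zero_iff)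
  then show ?thesis by (simp add: ext_ln_def)
next
  case False
  with x have pos: "x i > 0" if "i \<in> A" for i using that by (metis less_eq_real_def)
  have "ln (x i) \<le> ln (y i) + (x i - y i) / y i" if "i \<in> A" for i
    using ln_diff_le[OF pos[OF that] y[OF that]] by simp
  then have "(\<Sum>i\<in>A. ln (x i)) \<le> (\<Sum>i\<in>A. ln (y i) + (x i - y i) / y i)"
    by (rule sum_mono)
  with \<open>a \<ge> 0\<close> pos show ?thesis
    by (simp add: ext_ln_prod_powr mult_left_mono)
qed

context binary_game
begin

lemma trial_measurable: "i \<in> {1..N} \<Longrightarrow> Z i \<in> borel_measurable M"
  using indep by (simp add: indep_vars_def)

lemma has_bochner_integral_trial:
  fixes g :: "real \<Rightarrow> real"
  assumes i: "i \<in> {1..N}"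
  shows "has_bochner_integral M (\<lambda>\<omega>. g (Z i \<omega>)) (p * g 1 + q * g (-1))"
proof -
  note [measurable] = trial_measurable[OF i]
  have "has_bochner_integral M
      (\<lambda>\<omega>. indicator {\<omega> \<in> space M. Z i \<omega> = 1} \<omega> * g 1 +
           indicator {\<omega> \<in> space M. Z i \<omega> = -1} \<omega> * g (-1)) (p * g 1 + q * g (-1))"
    unfolding prob_win[OF i, symmetric] prob_loss[OF i, symmetric]
    by (intro has_bochner_integral_add has_bochner_integral_mult_left
        has_bochner_integral_real_indicator) (auto simp: less_top[symmetric])
  then show ?thesis
    by (rule has_bochner_integral_cong[THEN iffD1, rotated -1])
      (use outcome[OF i] in \<open>auto split: split_indicator\<close>)
qed

lemma has_bochner_integral_mean_trials:
  fixes g :: "real \<Rightarrow> real"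
  shows "has_bochner_integral M (\<lambda>\<omega>. 1 / N * (\<Sum>i=1..N. g (Z i \<omega>))) (p * g 1 + q * g (-1))"
proof -
  have "has_bochner_integral M (\<lambda>\<omega>. 1 / N * (\<Sum>i=1..N. g (Z i \<omega>)))
      (1 / N * (\<Sum>i=1..N. p * g 1 + q * g (-1)))"
    by (intro has_bochner_integral_mult_right has_bochner_integral_sum has_bochner_integral_trial)
  then show ?thesis using trials_pos by simp
qed

lemma AE_kelly_factor_pos:
  assumes "p > q" "q \<ge> 0"
  shows "AE \<omega> in M. \<forall>i\<in>{1..N}. 1 + (p - q) * Z i \<omega> > 0"
proof (intro AE_finite_allI)
  fix i assume i: "i \<in> {1..N}"
  note [measurable] = trial_measurable[OF i]
  have win: "1 + (p - q) * 1 > 0" using assms by simp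
  show "AE \<omega> in M. 1 + (p - q) * Z i \<omega> > 0"
  proof (cases "q = 0")
    case True
    with sum_p_q prob_win[OF i] have "AE \<omega> in M. \<omega> \<in> {\<omega> \<in> space M. Z i \<omega> = 1}"
      by (intro AE_prob_1) simp
    then show ?thesis by (rule eventually_mono) (use win in auto)
  next
    case False
    with assms sum_p_q have "1 + (p - q) * (-1) > 0" by simp
    with win outcome[OF i] show ?thesis by (intro AE_I2) force
  qed
qed simp

lemma utility_le_kelly:
  assumes "p > q" "q \<ge> 0" "W0 > 0" "F \<in> {0..1}"
  shows "utility M N Z W0 F \<le> utility M N Z W0 (p - q)"
proof -
  define G where "G = p - q"
  define L where "L z = ln (1 + G * z)" for z
  define D where "D z = (F - G) * z / (1 + G * z)" for z
  have rate: "\<bar>wealth W0 H Z N \<omega> / W0\<bar> powr (1 / N)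
      = \<bar>\<Prod>i=1..N. 1 + H * Z i \<omega>\<bar> powr (1 / N)" for H \<omega>
    using \<open>W0 > 0\<close> by (simp add: wealth_eq_prod)
  have pos: "AE \<omega> in M. \<forall>i\<in>{1..N}. 1 + G * Z i \<omega> > 0"
    unfolding G_def using assms by (intro AE_kelly_factor_pos) auto
  note IL = has_bochner_integral_mean_trials[of L]
  note ILD = has_bochner_integral_mean_trials[of "\<lambda>z. L z + D z"]
  have "p * D 1 + q * D (-1) \<le> 0"
  proof (cases "q = 0")
    case True
    then show ?thesis using sum_p_q \<open>F \<in> {0..1}\<close> by (simp add: D_def G_def)
  next
    case False
    have "D 1 = (F - G) / (2 * p)" "D (-1) = - (F - G) / (2 * q)"
      unfolding D_def by (rule arg_cong2[where f = "(/)"]; use sum_p_q in \<open>simp add: G_def\<close>)+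
    then show ?thesis using False assms by (simp flip: add_divide_distrib)
  qed
  then have drift: "p * (L 1 + D 1) + q * (L (-1) + D (-1)) \<le> p * L 1 + q * L (-1)"
    by (simp add: algebra_simps)
  have "utility M N Z W0 F \<le> ext_expectation M (\<lambda>\<omega>. ereal (1 / N * (\<Sum>i=1..N. L (Z i \<omega>) + D (Z i \<omega>))))"
    unfolding utility_def rate
  proof (rule ext_expectation_mono_AE)
    show "AE \<omega> in M. ext_ln (\<bar>\<Prod>i=1..N. 1 + F * Z i \<omega>\<bar> powr (1 / N))
        \<le> ereal (1 / N * (\<Sum>i=1..N. L (Z i \<omega>) + D (Z i \<omega>)))"
      using pos AE_space
    proof eventually_elim
      case (elim \<omega>)
      have "1 + F * Z i \<omega> \<ge> 0" if "i \<in> {1..N}" for i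
        using outcome[OF that elim(2)] \<open>F \<in> {0..1}\<close> by auto
      with elim(1) show ?case
        using ext_ln_prod_powr_le[of "{1..N}" "1 / N" "\<lambda>i. 1 + F * Z i \<omega>" "\<lambda>i. 1 + G * Z i \<omega>"]
        by (simp add: L_def D_def left_diff_distrib)
    qed
  qed
  also have "\<dots> = ereal (p * (L 1 + D 1) + q * (L (-1) + D (-1)))"
    using ILD by (simp add: has_bochner_integral_iff ext_expectation_ereal)
  also have "\<dots> \<le> ereal (p * L 1 + q * L (-1))"
    using drift by simp
  also have "\<dots> = ext_expectation M (\<lambda>\<omega>. ereal (1 / N * (\<Sum>i=1..N. L (Z i \<omega>))))"
    using IL by (simp add: has_bochner_integral_iff ext_expectation_ereal)
  also have "\<dots> \<le> utility M N Z W0 G"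
    unfolding utility_def rate
  proof (rule ext_expectation_mono_AE)
    show "AE \<omega> in M. ereal (1 / N * (\<Sum>i=1..N. L (Z i \<omega>)))
        \<le> ext_ln (\<bar>\<Prod>i=1..N. 1 + G * Z i \<omega>\<bar> powr (1 / N))"
      using pos by eventually_elim (subst ext_ln_prod_powr, auto simp: L_def)
  qed
  finally show ?thesis by (simp add: G_def)
qed

end

theorem theorem3p4:
  fixes M :: "'a measure" and N :: nat and Z :: "nat \<Rightarrow> 'a \<Rightarrow> real" and p q W0 :: real
  assumes "p \<in> {0..1}" and "q \<in> {0..1}" and "p + q = 1" and "p > q"
    and "binary_game M N Z p q"
    and "W0 > 0"
  shows "is_arg_max (\<lambda>F. utility M N Z W0 F) (\<lambda>F. F \<in> {0..1}) \<bar>p - q\<bar>"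
proof -
  have "utility M N Z W0 F \<le> utility M N Z W0 (p - q)" if "F \<in> {0..1}" for F
    using assms that by (intro binary_game.utility_le_kelly) auto
  with assms show ?thesis
    by (auto simp: is_arg_max_def not_less)
qed

end
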